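(* Let $A$ be a finite abelian group minimally generated by $d$ elements (i.e. $d$ is the minimal number of elements in a generating set of $A$). Then $\kappa(A)=d+1$.
   Context: For a finite group $G$ the Helly dimension $\kappa(G)$ is the minimal natural number $e$ (natural numbers are positive integers) such that any finite system of cosets $gH$ ($g\in G$, $H$ a subgroup of $G$) with empty intersection has a subsystem consisting of at most $e$ cosets with empty intersection. *)

theory Defs
  imports "HOL-Algebra.Generated_Groups"
begin

definition left_cosets :: "('a, 'b) monoid_scheme \<Rightarrow> 'a set set" where
  "left_cosets G = {g <#\<^bsub>G\<^esub> H | g H. g \<in> carrier G \<and> subgroup H G}"

(* The intersection is taken inside the group, so the empty system has intersection
   carrier G, which is nonempty. *)
definition helly_property :: "('a, 'b) monoid_scheme \<Rightarrow> nat \<Rightarrow> bool" where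
  "helly_property G e \<longleftrightarrow>
     (\<forall>\<C>. finite \<C> \<and> \<C> \<subseteq> left_cosets G \<and> carrier G \<inter> \<Inter>\<C> = {} \<longrightarrow>
        (\<exists>\<D>. \<D> \<subseteq> \<C> \<and> card \<D> \<le> e \<and> carrier G \<inter> \<Inter>\<D> = {}))"

(* The minimum is over positive integers; this only matters for the trivial group,
   where e = 0 would also have the Helly property. *)
definition helly_dimension :: "('a, 'b) monoid_scheme \<Rightarrow> nat" where
  "helly_dimension G = (LEAST e. 0 < e \<and> helly_property G e)"

(* Intended for finitely generated groups: LEAST is unspecified if no finite
   generating set exists. *)
definition min_generators :: "('a, 'b) monoid_scheme \<Rightarrow> nat" where
  "min_generators G =
     (LEAST n. \<exists>S. S \<subseteq> carrier G \<and> finite S \<and> card S = n \<and> generate G S = carrier G)"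

end

theory Submission
  imports Defs "HOL-Algebra.Multiplicative_Group" "HOL-Computational_Algebra.Primes"
begin

section \<open>Monomials in abelian groups\<close>

text \<open>Write G for the group and d for \<open>min_generators G\<close>.

  Upper bound. Among the subsystems with empty intersection take one of least cardinality. Its
  members are cosets C of subgroups H C, and each C has a point x C lying in all the other members.
  Fix a member C0 and put y C = x C / x C0 for the remaining C. Then y C lies in H C' whenever C'
  differs from C. Moreover one prime p divides every exponent k with (y C)^k in H C, for all C at
  once; otherwise a product of powers of the x C with exponent sum 1, an affine combination, would
  lie in every member. So the y C are independent modulo p-th powers in the subgroup B that they
  generate, and |B : B^p| is at least p to their number. In a finite abelian group kernel and
  cokernel of the p-th power map have the same order, and the kernel can only shrink in a subgroup.
  Hence the number of the y C is at most the size of any generating set of G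
  (\<open>card_le_card_generators\<close>), and C0 accounts for the summand 1
  (\<open>helly_property_Suc_card_generators\<close>).

  Lower bound. The number d is visible at a single prime: if every G/G^p were spanned by d - 1
  elements, these spanning sets could be merged into d - 1 generators of G
  (\<open>exists_generating_set\<close>). So some vector space G/G^p contains at least d independent
  vectors (\<open>exists_independent_mod_prime\<close>). For n > 0 independent vectors, the n
  coordinate hyperplanes of their span and the hyperplane of coordinate sum 1 have no common point,
  but any n of these n + 1 cosets share one, namely 0 or one of the vectors. This forces a Helly
  number above n (\<open>card_independent_less_helly\<close>).\<close>

definition monomial :: "('a, 'b) monoid_scheme \<Rightarrow> ('i \<Rightarrow> 'a) \<Rightarrow> 'i set \<Rightarrow> ('i \<Rightarrow> int) \<Rightarrow> 'a" where
  "monomial G x I a = finprod G (\<lambda>i. x i [^]\<^bsub>G\<^esub> a i) I"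

context comm_group
begin

lemma monomial_closed [simp]:
  "x \<in> I \<rightarrow> carrier G \<Longrightarrow> monomial G x I a \<in> carrier G"
  by (auto simp: monomial_def intro!: finprod_closed)

lemma monomial_mult:
  assumes "x \<in> I \<rightarrow> carrier G"
  shows "monomial G x I a \<otimes> monomial G x I b = monomial G x I (\<lambda>i. a i + b i)"
proof -
  have "monomial G x I (\<lambda>i. a i + b i) = finprod G (\<lambda>i. x i [^] a i \<otimes> x i [^] b i) I"
    unfolding monomial_def using assms by (intro finprod_cong') (auto simp: Pi_iff int_pow_mult)
  also have "\<dots> = monomial G x I a \<otimes> monomial G x I b"
    unfolding monomial_def using assms by (intro finprod_multf) auto
  finally show ?thesis by simp
qed

lemma monomial_0 [simp]: "monomial G x I (\<lambda>i. 0) = \<one>"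
  by (simp add: monomial_def)

lemma monomial_inv:
  assumes "x \<in> I \<rightarrow> carrier G"
  shows "inv (monomial G x I a) = monomial G x I (\<lambda>i. - a i)"
  using monomial_mult[OF assms, of a "\<lambda>i. - a i"] assms
  by (intro inv_equality) (simp_all add: m_comm)

lemma monomial_in_subgroup:
  assumes "subgroup H G" "\<And>i. i \<in> I \<Longrightarrow> x i [^] a i \<in> H"
  shows "monomial G x I a \<in> H"
  unfolding monomial_def using assms(2)
proof (induction I rule: infinite_finite_induct)
  case (insert i I)
  moreover have "(\<lambda>i. x i [^] a i) \<in> insert i I \<rightarrow> carrier G"
    using insert.prems subgroup.subset[OF assms(1)] by blast
  ultimately show ?case
    by (simp add: Pi_iff subgroup.m_closed[OF assms(1)])
qed (auto simp: subgroup.one_closed[OF assms(1)])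

lemma monomial_remove:
  assumes "finite I" "j \<in> I" "x \<in> I \<rightarrow> carrier G"
  shows "monomial G x I a = x j [^] a j \<otimes> monomial G x (I - {j}) a"
proof -
  have "I = insert j (I - {j})" using assms by auto
  then have "monomial G x I a = finprod G (\<lambda>i. x i [^] a i) (insert j (I - {j}))"
    by (simp add: monomial_def)
  also have "\<dots> = x j [^] a j \<otimes> monomial G x (I - {j}) a"
    unfolding monomial_def using assms by (intro finprod_insert) auto
  finally show ?thesis .
qed

lemma subgroup_mult_left_iff:
  assumes "subgroup H G" "h \<in> H" "y \<in> carrier G"
  shows "y \<otimes> h \<in> H \<longleftrightarrow> y \<in> H"
proof
  assume "y \<otimes> h \<in> H"
  then have "(y \<otimes> h) \<otimes> inv h \<in> H"
    using assms by (auto intro: subgroup.m_closed subgroup.m_inv_closed)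
  then show "y \<in> H"
    using assms subgroup.mem_carrier[OF assms(1,2)] by (simp add: m_assoc)
qed (use assms in \<open>auto intro: subgroup.m_closed\<close>)

text \<open>Modulo \<open>H\<close> only the \<open>j\<close>-th factor survives. This isolates a
  single exponent in the counting bound, in the merging of generators and in the hyperplane
  system.\<close>

lemma monomial_mem_subgroup_iff:
  assumes "finite I" "j \<in> I" "x \<in> I \<rightarrow> carrier G" "subgroup H G"
    and "\<And>i. i \<in> I \<Longrightarrow> i \<noteq> j \<Longrightarrow> x i [^] a i \<in> H"
  shows "monomial G x I a \<in> H \<longleftrightarrow> x j [^] a j \<in> H"
proof -
  have "monomial G x (I - {j}) a \<in> H"
    using assms(5) by (intro monomial_in_subgroup assms(4)) auto
  then show ?thesis
    unfolding monomial_remove[OF assms(1-3)] using assms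
    by (intro subgroup_mult_left_iff) auto
qed

lemma monomial_indicator:
  assumes "finite I" "j \<in> I" "x \<in> I \<rightarrow> carrier G"
  shows "monomial G x I (\<lambda>i. if i = j then 1 else 0) = x j"
proof -
  have "x j \<in> carrier G" using assms by auto
  moreover have "monomial G x (I - {j}) (\<lambda>i. if i = j then 1 else 0) = \<one>"
    unfolding monomial_def by (rule finprod_one_eqI) auto
  ultimately show ?thesis
    unfolding monomial_remove[OF assms] by simp
qed

lemma subgroup_range_monomial:
  assumes "x \<in> I \<rightarrow> carrier G"
  shows "subgroup (range (monomial G x I)) G"
proof (rule subgroupI)
  show "range (monomial G x I) \<subseteq> carrier G" using assms by auto
qed (use assms in \<open>auto simp: monomial_inv monomial_mult\<close>)

lemma generate_eq_range_monomial:
  assumes "finite I" "x \<in> I \<rightarrow> carrier G"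
  shows "generate G (x ` I) = range (monomial G x I)"
proof
  have "x ` I \<subseteq> range (monomial G x I)"
    using monomial_indicator[OF assms(1) _ assms(2)] by (auto simp: image_iff) metis
  then show "generate G (x ` I) \<subseteq> range (monomial G x I)"
    by (intro generate_subgroup_incl subgroup_range_monomial assms)
  have sub: "subgroup (generate G (x ` I)) G"
    using assms by (intro generate_is_subgroup) auto
  show "range (monomial G x I) \<subseteq> generate G (x ` I)"
    by (auto intro!: monomial_in_subgroup[OF sub] subgroup_int_pow_closed[OF sub] intro: generate.incl)
qed

text \<open>With exponent sum 1 this says that affine combinations commute with
  translations.\<close>

lemma monomial_shift:
  assumes "finite I" "x \<in> I \<rightarrow> carrier G" "u \<in> carrier G"
  shows "monomial G (\<lambda>i. x i \<otimes> u) I a = monomial G x I a \<otimes> u [^] (\<Sum>i\<in>I. a i)"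
  using assms(1,2)
proof (induction I)
  case (insert i I)
  have *: "monomial G y (insert i I) a = y i [^] a i \<otimes> monomial G y I a"
    if "y \<in> insert i I \<rightarrow> carrier G" for y
    using monomial_remove[of "insert i I" i y a] insert.hyps that by simp
  have c: "x i \<in> carrier G" "monomial G x I a \<in> carrier G" "x \<in> I \<rightarrow> carrier G"
    using insert.prems by auto
  have "(\<lambda>i. x i \<otimes> u) \<in> insert i I \<rightarrow> carrier G"
    using insert.prems assms(3) by auto
  then show ?case
    using insert c assms(3) by (simp add: * int_pow_distrib int_pow_mult m_ac)
qed (simp add: monomial_def)

section \<open>Cosets and their affine combinations\<close>

lemma mem_l_coset_iff:
  assumes "subgroup H G" "g \<in> carrier G"
  shows "y \<in> g <# H \<longleftrightarrow> y \<in> carrier G \<and> y \<otimes> inv g \<in> H"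
proof safe
  assume "y \<in> g <# H"
  then obtain h where h: "h \<in> H" "y = g \<otimes> h" by (auto simp: l_coset_def)
  moreover have "h \<in> carrier G" using h assms by (auto intro: subgroup.mem_carrier)
  ultimately show "y \<in> carrier G" "y \<otimes> inv g \<in> H"
    using assms by (simp_all add: m_comm[of g h] m_assoc)
next
  assume "y \<in> carrier G" "y \<otimes> inv g \<in> H"
  moreover from this have "y = g \<otimes> (y \<otimes> inv g)"
    using assms by (simp add: m_comm[of y] m_assoc[symmetric])
  ultimately show "y \<in> g <# H" by (auto simp: l_coset_def)
qed

lemma l_coset_diff:
  assumes "subgroup H G" "g \<in> carrier G" "x \<in> g <# H" "y \<in> g <# H"
  shows "y \<otimes> inv x \<in> H"
proof -
  have *: "x \<in> carrier G" "x \<otimes> inv g \<in> H" "y \<in> carrier G" "y \<otimes> inv g \<in> H"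
    using assms by (auto simp: mem_l_coset_iff)
  have "(y \<otimes> inv g) \<otimes> inv (x \<otimes> inv g) \<in> H"
    using subgroup.m_closed[OF assms(1) *(4) subgroup.m_inv_closed[OF assms(1) *(2)]] .
  moreover have "(y \<otimes> inv g) \<otimes> inv (x \<otimes> inv g) = y \<otimes> inv x"
    using * assms(2) by (simp add: inv_mult_group m_assoc inv_solve_left')
  ultimately show ?thesis by simp
qed

lemma l_coset_add:
  assumes "subgroup H G" "g \<in> carrier G" "x \<in> g <# H" "y \<in> carrier G"
  shows "x \<otimes> y \<in> g <# H \<longleftrightarrow> y \<in> H"
proof -
  have *: "x \<in> carrier G" "x \<otimes> inv g \<in> H"
    using assms by (auto simp: mem_l_coset_iff)
  have "x \<otimes> y \<otimes> inv g = y \<otimes> (x \<otimes> inv g)"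
    using * assms by (simp add: m_ac)
  then show ?thesis
    using * assms by (simp add: mem_l_coset_iff subgroup_mult_left_iff)
qed

text \<open>Cosets are closed under affine combinations: translation by \<open>inv g\<close> moves
  the points into \<open>H\<close>, and the exponent sum 1 moves the product by exactly one
  \<open>inv g\<close>.\<close>

lemma monomial_in_l_coset:
  assumes "subgroup H G" "g \<in> carrier G" "finite I"
    and "\<And>i. i \<in> I \<Longrightarrow> x i \<in> g <# H" "(\<Sum>i\<in>I. a i) = 1"
  shows "monomial G x I a \<in> g <# H"
proof -
  have x: "x \<in> I \<rightarrow> carrier G" using assms by (auto simp: mem_l_coset_iff)
  have "monomial G (\<lambda>i. x i \<otimes> inv g) I a \<in> H"
    using assms by (intro monomial_in_subgroup subgroup_int_pow_closed) (auto simp: mem_l_coset_iff)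
  moreover have "monomial G (\<lambda>i. x i \<otimes> inv g) I a = monomial G x I a \<otimes> inv g"
    using assms x by (simp add: monomial_shift)
  ultimately show ?thesis using assms x by (simp add: mem_l_coset_iff)
qed

end

section \<open>Counting modulo powers\<close>

context comm_group
begin

definition powers :: "int \<Rightarrow> 'a set" where
  "powers k = (\<lambda>x. x [^] k) ` carrier G"

lemma subgroup_image_pow:
  assumes "subgroup B G"
  shows "subgroup ((\<lambda>x. x [^] (k::int)) ` B) G"
proof (rule subgroupI)
  show "(\<lambda>x. x [^] k) ` B \<subseteq> carrier G"
    using subgroup.mem_carrier[OF assms] by auto
  show "(\<lambda>x. x [^] k) ` B \<noteq> {}" using subgroup.one_closed[OF assms] by auto
next
  fix y assume "y \<in> (\<lambda>x. x [^] k) ` B"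
  then obtain x where "x \<in> B" "y = x [^] k" by auto
  then have "inv y = (inv x) [^] k" "inv x \<in> B"
    using assms by (auto simp: int_pow_inv subgroup.mem_carrier subgroup.m_inv_closed)
  then show "inv y \<in> (\<lambda>x. x [^] k) ` B" by auto
next
  fix y z assume "y \<in> (\<lambda>x. x [^] k) ` B" "z \<in> (\<lambda>x. x [^] k) ` B"
  then obtain u v where "u \<in> B" "y = u [^] k" "v \<in> B" "z = v [^] k" by auto
  then have "y \<otimes> z = (u \<otimes> v) [^] k" "u \<otimes> v \<in> B"
    using assms by (auto simp: int_pow_distrib subgroup.mem_carrier subgroup.m_closed)
  then show "y \<otimes> z \<in> (\<lambda>x. x [^] k) ` B" by auto
qed

lemma subgroup_powers: "subgroup (powers k) G"
  unfolding powers_def by (intro subgroup_image_pow subgroup_self)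

text \<open>The \<open>k\<close>-th power map is a homomorphism on \<open>B\<close>, so each of its
  fibres is a translate of its kernel, the \<open>k\<close>-torsion.\<close>

lemma card_torsion_times_card_powers:
  fixes k :: int
  assumes "subgroup B G" "finite B"
  shows "card B = card {x \<in> B. x [^] k = \<one>} * card ((\<lambda>x. x [^] k) ` B)"
proof -
  have fibre: "card {x \<in> B. x [^] k = y} = card {x \<in> B. x [^] k = \<one>}"
    if y: "y \<in> (\<lambda>x. x [^] k) ` B" for y
  proof -
    obtain b where b: "b \<in> B" "y = b [^] k" using y by blast
    note c = subgroup.mem_carrier[OF assms(1)]
    have "bij_betw (\<lambda>x. x \<otimes> b) {x \<in> B. x [^] k = \<one>} {x \<in> B. x [^] k = y}"
    proof (rule bij_betwI[where g = "\<lambda>x. x \<otimes> inv b"])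
      show "(\<lambda>x. x \<otimes> b) \<in> {x \<in> B. x [^] k = \<one>} \<rightarrow> {x \<in> B. x [^] k = y}"
        using b assms(1) c by (auto simp: int_pow_distrib subgroup.m_closed)
      show "(\<lambda>x. x \<otimes> inv b) \<in> {x \<in> B. x [^] k = y} \<rightarrow> {x \<in> B. x [^] k = \<one>}"
        using b assms(1) c
        by (auto simp: int_pow_distrib int_pow_inv subgroup.m_closed subgroup.m_inv_closed)
    qed (use b c in \<open>auto simp: m_assoc\<close>)
    then show ?thesis by (simp add: bij_betw_same_card)
  qed
  have "card B = (\<Sum>y\<in>(\<lambda>x. x [^] k) ` B. card {x \<in> B. x [^] k = y})"
    using sum.image_gen[OF assms(2), of "\<lambda>_. 1 :: nat" "\<lambda>x. x [^] k"] by simp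
  then show ?thesis by (simp add: fibre)
qed

lemma monomial_pow:
  fixes k :: int
  assumes "x \<in> I \<rightarrow> carrier G" "finite I"
  shows "monomial G x I a [^] k = monomial G x I (\<lambda>i. a i * k)"
  using assms(2,1)
proof (induction I)
  case (insert i I)
  have *: "monomial G x (insert i I) b = x i [^] b i \<otimes> monomial G x I b" for b
    using monomial_remove[of "insert i I" i x b] insert by simp
  show ?case using insert by (auto simp: * int_pow_distrib int_pow_pow)
qed (simp add: monomial_def)

text \<open>Division with remainder in every exponent. The \<open>restrict\<close> fixes the
  residues outside \<open>I\<close>, so that they form an element of a \<open>PiE\<close> and can be
  counted.\<close>

lemma monomial_split_mod:
  assumes "x \<in> I \<rightarrow> carrier G" "finite I"
  shows "monomial G x I a = monomial G x I (restrict (\<lambda>i. a i mod k) I)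
           \<otimes> monomial G x I (\<lambda>i. a i div k) [^] k"
proof -
  have "monomial G x I (restrict (\<lambda>i. a i mod k) I) = monomial G x I (\<lambda>i. a i mod k)"
    unfolding monomial_def using assms by (intro finprod_cong') auto
  then show ?thesis using assms by (simp add: monomial_mult monomial_pow)
qed

text \<open>Up to a \<open>p\<close>-th power, exponents matter only modulo \<open>p\<close>, which
  leaves at most \<open>p\<close> choices per generator.\<close>

lemma card_le_power_times_card_powers:
  assumes "finite (carrier G)" "S \<subseteq> carrier G" "generate G S = carrier G" "p > 0"
  shows "card (carrier G) \<le> p ^ card S * card (powers (int p))"
proof -
  have S: "finite S" "(\<lambda>s. s) \<in> S \<rightarrow> carrier G"
    using assms finite_subset by auto
  define R where "R = (PiE S (\<lambda>_. {0..<int p})) \<times> powers (int p)"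
  have fin: "finite R"
    using S assms(1) by (auto simp: R_def powers_def intro!: finite_PiE)
  have "carrier G \<subseteq> (\<lambda>(r, y). monomial G (\<lambda>s. s) S r \<otimes> y) ` R"
  proof
    fix g assume "g \<in> carrier G"
    then obtain a where a: "g = monomial G (\<lambda>s. s) S a"
      using generate_eq_range_monomial[OF S] assms(3) by auto
    have "(restrict (\<lambda>i. a i mod int p) S, monomial G (\<lambda>s. s) S (\<lambda>i. a i div int p) [^] int p) \<in> R"
      using assms(4) S by (auto simp: R_def powers_def)
    then show "g \<in> (\<lambda>(r, y). monomial G (\<lambda>s. s) S r \<otimes> y) ` R"
      unfolding a monomial_split_mod[OF S(2,1), of a "int p"] by force
  qed
  then have "card (carrier G) \<le> card R"
    using fin by (meson card_image_le card_mono finite_imageI le_trans)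
  also have "card R = p ^ card S * card (powers (int p))"
    by (simp add: R_def card_cartesian_product card_PiE S)
  finally show ?thesis .
qed

text \<open>\<open>H j\<close> contains all \<open>x i\<close> with \<open>i\<close> different from
  \<open>j\<close>, so it reads off the exponent of \<open>x j\<close> modulo \<open>p\<close>.
  Hence monomials with different exponent vectors in \<open>{0..<p}\<close> lie in different cosets
  of the \<open>p\<close>-th powers of \<open>B\<close>.\<close>

lemma power_times_card_powers_le_card:
  assumes "finite (carrier G)" "finite I" "x \<in> I \<rightarrow> carrier G"
    and H: "\<And>i. i \<in> I \<Longrightarrow> subgroup (H i) G"
    and off: "\<And>i j. i \<in> I \<Longrightarrow> j \<in> I \<Longrightarrow> i \<noteq> j \<Longrightarrow> x i \<in> H j"
    and diag: "\<And>i k. i \<in> I \<Longrightarrow> x i [^] (k::int) \<in> H i \<Longrightarrow> int p dvd k"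
  defines "B \<equiv> range (monomial G x I)"
  shows "p ^ card I * card ((\<lambda>y. y [^] int p) ` B) \<le> card B"
proof -
  have B: "subgroup B G" unfolding B_def by (intro subgroup_range_monomial assms)
  have fin: "finite B" using assms(1) B subgroup.subset finite_subset by metis
  define R where "R = (PiE I (\<lambda>_. {0..<int p})) \<times> (\<lambda>y. y [^] int p) ` B"
  have "card R \<le> card B"
  proof (rule card_inj_on_le[OF _ _ fin])
    have "(\<lambda>y. y [^] int p) ` B \<subseteq> B"
      using B by (auto intro: subgroup_int_pow_closed)
    then show "(\<lambda>(r, y). monomial G x I r \<otimes> y) ` R \<subseteq> B"
      using B by (auto simp: R_def B_def intro!: subgroup.m_closed)
    show "inj_on (\<lambda>(r, y). monomial G x I r \<otimes> y) R"
    proof (rule inj_onI, clarify)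
      fix r y s z
      assume R: "(r, y) \<in> R" "(s, z) \<in> R" and eq: "monomial G x I r \<otimes> y = monomial G x I s \<otimes> z"
      obtain b c where b: "y = monomial G x I b [^] int p" and c: "z = monomial G x I c [^] int p"
        using R by (auto simp: R_def B_def)
      define e where "e = (\<lambda>i. r i + b i * int p + - (s i + c i * int p))"
      have "monomial G x I (\<lambda>i. r i + b i * int p) = monomial G x I (\<lambda>i. s i + c i * int p)"
        using eq by (simp add: b c monomial_pow monomial_mult assms)
      then have "monomial G x I (\<lambda>i. r i + b i * int p) \<otimes> inv (monomial G x I (\<lambda>i. s i + c i * int p)) = \<one>"
        by (simp add: assms)
      then have e: "monomial G x I e = \<one>"
        by (simp only: monomial_inv monomial_mult assms(3) e_def)
      have "r j = s j" if "j \<in> I" for j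
      proof -
        have "x j [^] e j \<in> H j"
          using that e subgroup.one_closed[OF H[OF that]]
          by (subst monomial_mem_subgroup_iff[OF assms(2) that assms(3) H[OF that], symmetric])
             (auto simp: off H that intro!: subgroup_int_pow_closed)
        then have "int p dvd e j" by (rule diag[OF that])
        moreover have "e j = (r j - s j) + int p * (b j - c j)"
          by (simp add: e_def algebra_simps)
        ultimately have "int p dvd r j - s j"
          by (metis dvd_add_left_iff dvd_triv_left)
        then have "r j mod int p = s j mod int p" by (simp add: mod_eq_dvd_iff)
        moreover have "r j \<in> {0..<int p}" "s j \<in> {0..<int p}"
          using R that by (auto simp: R_def)
        ultimately show ?thesis by simp
      qed
      then have "r = s" using R by (auto simp: R_def intro: PiE_ext)
      moreover have "y \<in> carrier G" "z \<in> carrier G"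
        by (simp_all add: b c assms)
      ultimately show "r = s \<and> y = z" using eq assms(3) by simp
    qed
  qed
  also have "card R = p ^ card I * card ((\<lambda>y. y [^] int p) ` B)"
    by (simp add: R_def card_cartesian_product card_PiE assms(2))
  finally show ?thesis by (simp add: mult.commute)
qed

text \<open>
  With \<open>B\<close> the subgroup generated by the \<open>x i\<close>, the bound is
  \<open>p ^ card I \<le> |B : B\<^sup>p| = |B[p]| \<le> |G[p]| = |G : G\<^sup>p| \<le> p ^ card S\<close>.
\<close>

lemma card_le_card_generators:
  assumes "finite (carrier G)" "finite I" "x \<in> I \<rightarrow> carrier G"
    and "\<And>i. i \<in> I \<Longrightarrow> subgroup (H i) G"
    and "\<And>i j. i \<in> I \<Longrightarrow> j \<in> I \<Longrightarrow> i \<noteq> j \<Longrightarrow> x i \<in> H j"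
    and "\<And>i k. i \<in> I \<Longrightarrow> x i [^] (k::int) \<in> H i \<Longrightarrow> int p dvd k"
    and "p > 1" "S \<subseteq> carrier G" "generate G S = carrier G"
  shows "card I \<le> card S"
proof -
  define B where "B = range (monomial G x I)"
  have B: "subgroup B G" unfolding B_def by (intro subgroup_range_monomial assms)
  have fin: "finite B" using assms(1) B subgroup.subset finite_subset by metis
  define P where "P = (\<lambda>y. y [^] int p) ` B"
  have pos: "card P > 0" "card (powers (int p)) > 0"
    using fin subgroup.one_closed[OF B] assms(1) by (auto simp: P_def powers_def card_gt_0_iff)
  have "p ^ card I * card P \<le> card B"
    unfolding P_def B_def by (rule power_times_card_powers_le_card) (use assms in auto)
  also have "\<dots> = card {x \<in> B. x [^] int p = \<one>} * card P"
    unfolding P_def by (rule card_torsion_times_card_powers[OF B fin])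
  finally have "p ^ card I \<le> card {x \<in> B. x [^] int p = \<one>}" using pos by simp
  also have "\<dots> \<le> card {x \<in> carrier G. x [^] int p = \<one>}"
    using assms(1) subgroup.subset[OF B] by (intro card_mono) auto
  also have "\<dots> \<le> p ^ card S"
  proof -
    have "card {x \<in> carrier G. x [^] int p = \<one>} * card (powers (int p)) = card (carrier G)"
      unfolding powers_def using assms(1) by (intro card_torsion_times_card_powers[symmetric] subgroup_self)
    also have "\<dots> \<le> p ^ card S * card (powers (int p))"
      using assms by (intro card_le_power_times_card_powers) auto
    finally show ?thesis using pos by simp
  qed
  finally show ?thesis using assms(7) by simp
qed

end

section \<open>The upper bound\<close>

text \<open>\<open>J\<close> is a subgroup of the integers other than the whole, hence the multiples
  of some \<open>k\<close> different from 1. A prime factor of \<open>k\<close> works, and for the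
  zero subgroup any prime does.\<close>

lemma int_subgroup_exists_prime_dvd:
  fixes J :: "int set"
  assumes "0 \<in> J" "\<And>a b. a \<in> J \<Longrightarrow> b \<in> J \<Longrightarrow> a - b \<in> J" "1 \<notin> J"
  shows "\<exists>p::nat. prime p \<and> (\<forall>j\<in>J. int p dvd j)"
proof (cases "J \<subseteq> {0}")
  case True
  then show ?thesis using two_is_prime_nat by (intro exI[of _ 2]) auto
next
  case False
  have uminus: "- a \<in> J" if "a \<in> J" for a
    using assms(2)[OF assms(1) that] by simp
  from False obtain j where "j \<in> J" "j \<noteq> 0" by auto
  then have "\<exists>n::nat. n > 0 \<and> int n \<in> J"
    using uminus by (intro exI[of _ "nat \<bar>j\<bar>"]) (auto simp: abs_if)
  then obtain k :: nat where k: "k > 0" "int k \<in> J"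
    and least: "\<And>n::nat. n > 0 \<Longrightarrow> int n \<in> J \<Longrightarrow> k \<le> n"
    using exists_least_iff[of "\<lambda>n::nat. n > 0 \<and> int n \<in> J"] by (metis not_le)
  have neg_mult: "- (int k * int n) \<in> J" for n
  proof (induction n)
    case (Suc n)
    have "- (int k * int n) - int k = - (int k * int (Suc n))" by (simp add: algebra_simps)
    with assms(2)[OF Suc k(2)] show ?case by metis
  qed (simp add: assms(1))
  have mult: "int k * m \<in> J" for m
    using neg_mult[of "nat \<bar>m\<bar>"] uminus[OF neg_mult[of "nat \<bar>m\<bar>"]] by (auto simp: abs_if split: if_splits)
  have dvd: "int k dvd j" if "j \<in> J" for j
  proof (rule ccontr)
    assume n: "\<not> int k dvd j"
    have "j mod int k \<in> J"
      using assms(2)[OF that mult[of "j div int k"]] by (simp add: minus_mult_div_eq_mod)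
    moreover have "j mod int k > 0"
      using n k(1) pos_mod_sign[of "int k" j] mod_0_imp_dvd[of j "int k"] by linarith
    ultimately have "k \<le> nat (j mod int k)" by (intro least) auto
    moreover have "nat (j mod int k) < k" using k(1) by (simp add: nat_less_iff)
    ultimately show False by simp
  qed
  have "k \<noteq> 1" using assms(3) k by auto
  then obtain p where "prime p" "p dvd k" using prime_factor_nat by blast
  then show ?thesis using dvd by (metis dvd_trans of_nat_dvd_iff)
qed

context comm_group
begin

text \<open>
  In a minimal system with empty intersection pick a point \<open>x C\<close> lying in all members but \<open>C\<close>.
  If no prime divided the orders of all \<open>x C \<otimes> inv (x C0)\<close> modulo \<open>H C\<close>, then an affine
  combination of the \<open>x C\<close> would lie in the whole intersection.
\<close>

lemma helly_property_Suc_card_generators: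
  assumes "finite (carrier G)" "S \<subseteq> carrier G" "generate G S = carrier G"
  shows "helly_property G (card S + 1)"
  unfolding helly_property_def
proof (intro allI impI, elim conjE)
  fix \<C> assume C: "finite \<C>" "\<C> \<subseteq> left_cosets G" "carrier G \<inter> \<Inter>\<C> = {}"
  have "\<exists>\<D>. (\<D> \<subseteq> \<C> \<and> carrier G \<inter> \<Inter>\<D> = {}) \<and>
      (\<forall>\<E>. \<E> \<subseteq> \<C> \<and> carrier G \<inter> \<Inter>\<E> = {} \<longrightarrow> card \<D> \<le> card \<E>)"
    by (rule ex_has_least_nat[where P = "\<lambda>\<E>. \<E> \<subseteq> \<C> \<and> carrier G \<inter> \<Inter>\<E> = {}"]) (use C in auto)
  then obtain \<D> where D: "\<D> \<subseteq> \<C>" "carrier G \<inter> \<Inter>\<D> = {}"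
    and "\<forall>\<E>. \<E> \<subseteq> \<C> \<and> carrier G \<inter> \<Inter>\<E> = {} \<longrightarrow> card \<D> \<le> card \<E>"
    by (elim exE conjE)
  then have least: "card \<D> \<le> card \<E>" if "\<E> \<subseteq> \<C>" "carrier G \<inter> \<Inter>\<E> = {}" for \<E>
    using that by simp
  have fin: "finite \<D>" using D C finite_subset by blast
  have "\<exists>x. x \<in> carrier G \<inter> \<Inter>(\<D> - {C})" if "C \<in> \<D>" for C
  proof (rule ccontr)
    assume "\<not> ?thesis"
    then have "card \<D> \<le> card (\<D> - {C})" using D(1) by (intro least) blast+
    then show False using card_Diff1_less[OF fin that] by simp
  qed
  then obtain x where x: "\<And>C. C \<in> \<D> \<Longrightarrow> x C \<in> carrier G \<inter> \<Inter>(\<D> - {C})"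
    by metis
  then have xc: "x C \<in> carrier G" if "C \<in> \<D>" for C using that by auto
  have x_in: "x C \<in> C'" if "C \<in> \<D>" "C' \<in> \<D>" "C \<noteq> C'" for C C' using x that by auto
  have "\<exists>g H. g \<in> carrier G \<and> subgroup H G \<and> C = g <# H" if "C \<in> \<D>" for C
  proof -
    have "C \<in> left_cosets G" using that D(1) C(2) by blast
    then show ?thesis unfolding left_cosets_def by blast
  qed
  then have "\<forall>C\<in>\<D>. \<exists>g H. g \<in> carrier G \<and> subgroup H G \<and> C = g <# H" by blast
  from this[unfolded bchoice_iff] obtain g H where g: "\<And>C. C \<in> \<D> \<Longrightarrow> g C \<in> carrier G"
    and H: "\<And>C. C \<in> \<D> \<Longrightarrow> subgroup (H C) G"
    and gH: "\<And>C. C \<in> \<D> \<Longrightarrow> C = g C <# H C" by blast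
  have "\<D> \<noteq> {}" using D(2) by auto
  then obtain C0 where C0: "C0 \<in> \<D>" by auto
  \<comment> \<open>Quotients by the base point \<open>x C0\<close> turn affine combinations into
    arbitrary monomials. Dropping \<open>C0\<close> is what later gives the summand 1.\<close>
  define I where "I = \<D> - {C0}"
  define y where "y C = x C \<otimes> inv (x C0)" for C
  have I: "finite I" "I \<subseteq> \<D>" using fin by (auto simp: I_def)
  have HI: "subgroup (H C) G" if "C \<in> I" for C using that I(2) by (intro H) blast
  have yc: "y \<in> I \<rightarrow> carrier G" using I xc C0 by (auto simp: y_def)
  have y_in: "y C \<in> H C'" if "C \<in> I" "C' \<in> I" "C \<noteq> C'" for C C'
  proof -
    have C': "C' \<in> \<D>" using that by (auto simp: I_def)
    have "x C \<in> C'" "x C0 \<in> C'" using that x_in C0 by (auto simp: I_def)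
    then show ?thesis
      unfolding y_def using l_coset_diff[OF H[OF C'] g[OF C']] gH[OF C'] by simp
  qed
  \<comment> \<open>Admissible exponents make the monomial in \<open>y\<close> fall into every
    \<open>H C\<close> with \<open>C\<close> in \<open>I\<close>. Their sums form a subgroup
    \<open>J\<close> of the integers, and \<open>1 \<in> J\<close> would produce an admissible
    affine combination.\<close>
  define adm where "adm a \<longleftrightarrow> (\<forall>C\<in>I. y C [^] a C \<in> H C)" for a :: "'a set \<Rightarrow> int"
  define J where "J = {(\<Sum>C\<in>I. a C) | a. adm a}"
  have "1 \<notin> J"
  proof
    assume "1 \<in> J"
    then obtain a where a: "adm a" "(\<Sum>C\<in>I. a C) = 1" by (auto simp: J_def)
    define w where "w = monomial G x I a"
    have xI: "x \<in> I \<rightarrow> carrier G" using xc I by auto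
    \<comment> \<open>Two views of \<open>w\<close>: as an affine combination of points of
      \<open>C0\<close> it lies in \<open>C0\<close>; as \<open>x C0\<close> times an admissible
      monomial it lies in every other member. The sum 1 makes both agree.\<close>
    have w: "w = x C0 \<otimes> monomial G y I a"
      unfolding w_def y_def[abs_def] using xI xc[OF C0] I a(2)
      by (simp add: monomial_shift m_lcomm[of "x C0" "monomial G x I a"])
    have "w \<in> C" if "C \<in> \<D>" for C
    proof (cases "C = C0")
      case True
      have "x C' \<in> g C0 <# H C0" if "C' \<in> I" for C'
        using x_in[of C' C0] that C0 gH[OF C0] by (auto simp: I_def)
      then have "w \<in> g C0 <# H C0"
        unfolding w_def using a(2) I by (intro monomial_in_l_coset H g C0) auto
      then show ?thesis using True gH[OF C0] by simp
    next
      case False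
      then have CI: "C \<in> I" using that by (simp add: I_def)
      have "monomial G y I a \<in> H C"
      proof (intro monomial_in_subgroup H that)
        fix C' assume "C' \<in> I"
        then show "y C' [^] a C' \<in> H C"
          using a(1) y_in[of C' C] CI subgroup_int_pow_closed[OF H[OF that]]
          by (cases "C' = C") (auto simp: adm_def)
      qed
      moreover have "x C0 \<in> g C <# H C" using x_in[OF C0 that] False gH[OF that] by auto
      ultimately have "w \<in> g C <# H C"
        unfolding w using yc H[OF that] g[OF that] by (subst l_coset_add) auto
      then show ?thesis using gH[OF that] by simp
    qed
    moreover have "w \<in> carrier G" using xI by (simp add: w_def)
    ultimately show False using D(2) by auto
  qed
  moreover have "0 \<in> J"
    using HI by (auto simp: J_def adm_def intro!: exI[of _ "\<lambda>_. 0"] subgroup.one_closed)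
  moreover have "s - t \<in> J" if "s \<in> J" "t \<in> J" for s t
  proof -
    obtain a b where ab: "adm a" "s = (\<Sum>C\<in>I. a C)" "adm b" "t = (\<Sum>C\<in>I. b C)"
      using \<open>s \<in> J\<close> \<open>t \<in> J\<close> by (auto simp: J_def)
    have "adm (\<lambda>C. a C - b C)"
      unfolding adm_def
    proof
      fix C assume "C \<in> I"
      then have C: "y C [^] a C \<in> H C" "y C [^] b C \<in> H C" "subgroup (H C) G" "y C \<in> carrier G"
        using ab HI yc by (auto simp: adm_def)
      then show "y C [^] (a C - b C) \<in> H C"
        by (simp add: int_pow_diff subgroup.m_closed subgroup.m_inv_closed)
    qed
    then show ?thesis using ab by (auto simp: J_def sum_subtractf intro!: exI[of _ "\<lambda>C. a C - b C"])
  qed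
  ultimately obtain p where p: "prime p" "\<And>j. j \<in> J \<Longrightarrow> int p dvd j"
    using int_subgroup_exists_prime_dvd[of J] by blast
  have "int p dvd k" if "C \<in> I" "y C [^] k \<in> H C" for C k
  proof -
    \<comment> \<open>Exponents concentrated at one \<open>C\<close> put \<open>k\<close> itself
      into \<open>J\<close>.\<close>
    have "adm (\<lambda>C'. if C' = C then k else 0)"
      using that HI by (auto simp: adm_def intro: subgroup.one_closed)
    then have "(\<Sum>C'\<in>I. if C' = C then k else 0) \<in> J" by (auto simp: J_def)
    then show ?thesis using p(2) that(1) I(1) by simp
  qed
  then have "card I \<le> card S"
    using prime_gt_1_nat[OF p(1)] HI I(1) y_in
    by (intro card_le_card_generators[of I y H p] assms yc) auto
  then have "card \<D> \<le> card S + 1"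
    using C0 fin by (simp add: I_def card_Diff_singleton)
  then show "\<exists>\<D>\<subseteq>\<C>. card \<D> \<le> card S + 1 \<and> carrier G \<inter> \<Inter>\<D> = {}"
    using D by blast
qed

end

section \<open>The lower bound\<close>

context comm_group
begin

text \<open>For prime \<open>p\<close> this is the preimage in \<open>G\<close> of the span of
  \<open>T\<close> in the vector space G/G^p over the field with \<open>p\<close> elements.\<close>

definition span_mod :: "nat \<Rightarrow> 'a set \<Rightarrow> 'a set" where
  "span_mod p T = generate G T <#> powers (int p)"

lemma mem_span_mod_iff:
  "x \<in> span_mod p T \<longleftrightarrow> (\<exists>u\<in>generate G T. \<exists>v\<in>carrier G. x = u \<otimes> v [^] int p)"
  by (auto simp: span_mod_def set_mult_def powers_def)

lemma subgroup_span_mod: "T \<subseteq> carrier G \<Longrightarrow> subgroup (span_mod p T) G"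
  unfolding span_mod_def by (intro mult_subgroups generate_is_subgroup subgroup_powers)

lemma subset_span_mod:
  assumes "T \<subseteq> carrier G"
  shows "T \<subseteq> span_mod p T" "powers (int p) \<subseteq> span_mod p T"
proof
  fix t assume t: "t \<in> T"
  then have "t = t \<otimes> \<one> [^] int p" using assms by auto
  then show "t \<in> span_mod p T"
    unfolding mem_span_mod_iff using t by (blast intro: generate.incl)
next
  show "powers (int p) \<subseteq> span_mod p T"
  proof
    fix y assume "y \<in> powers (int p)"
    then obtain x where "x \<in> carrier G" "y = \<one> \<otimes> x [^] int p" by (auto simp: powers_def)
    then show "y \<in> span_mod p T"
      unfolding mem_span_mod_iff by (blast intro: generate.one)
  qed
qed

lemma span_mod_subset:
  assumes "subgroup K G" "T \<subseteq> K" "powers (int p) \<subseteq> K"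
  shows "span_mod p T \<subseteq> K"
proof -
  have "generate G T \<subseteq> K" using assms by (intro generate_subgroup_incl)
  then show ?thesis
    using assms(3) by (auto simp: span_mod_def set_mult_def intro!: subgroup.m_closed[OF assms(1)])
qed

section \<open>From spanning modulo primes to generating\<close>

lemma mem_subgroup_of_coprime_pows:
  fixes a b :: int
  assumes "subgroup H G" "x \<in> carrier G" "x [^] a \<in> H" "x [^] b \<in> H" "coprime a b"
  shows "x \<in> H"
proof -
  obtain u v where uv: "u * a + v * b = 1"
    using bezout_int[of a b] assms(5) by auto
  have "(x [^] a) [^] u \<otimes> (x [^] b) [^] v \<in> H"
    using subgroup.m_closed[OF assms(1) subgroup_int_pow_closed[OF assms(1,3)]
        subgroup_int_pow_closed[OF assms(1,4)]] .
  moreover have "(x [^] a) [^] u \<otimes> (x [^] b) [^] v = x [^] (u * a + v * b)"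
    using assms(2) by (simp add: int_pow_pow int_pow_mult mult.commute)
  ultimately show ?thesis using assms(2) uv by simp
qed

text \<open>If every element is a product of an element of <S> and an \<open>m\<close>-th power, and
  likewise for \<open>p\<close>, substituting one representation into the other gives the same for
  \<open>p * m\<close>. Climbing through the divisors reaches \<open>order G\<close>, whose powers
  are trivial.\<close>

lemma generate_eq_carrier_if_span_mod:
  assumes fin: "finite (carrier G)" and S: "S \<subseteq> carrier G"
    and span: "\<And>p. prime p \<Longrightarrow> p dvd order G \<Longrightarrow> span_mod p S = carrier G"
  shows "generate G S = carrier G"
proof -
  have sub: "subgroup (generate G S) G" by (rule generate_is_subgroup[OF S])
  have "span_mod k S = carrier G" if "k dvd order G" for k
    using that
  proof (induction k rule: less_induct)
    case (less k)
    have pos: "k > 0"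
      using less.prems fin order_gt_0_iff_finite by (metis dvd_pos_nat)
    show ?case
    proof (cases "k = 1")
      case True
      have "g \<in> span_mod 1 S" if "g \<in> carrier G" for g
        unfolding mem_span_mod_iff using that
        by (intro bexI[of _ \<one>] bexI[of _ g]) (auto intro: generate.one)
      then show ?thesis using True subgroup.subset[OF subgroup_span_mod[OF S]] by auto
    next
      case False
      then obtain p where p: "prime p" "p dvd k" using prime_factor_nat by blast
      then obtain m where m: "k = p * m" by auto
      have "m < k" using m pos prime_gt_1_nat[OF p(1)] by auto
      moreover have "m dvd order G" "p dvd order G" using less.prems m by (auto intro: dvd_trans)
      ultimately have eq: "span_mod m S = carrier G" "span_mod p S = carrier G"
        using less.IH span p by auto
      have "g \<in> span_mod k S" if g: "g \<in> carrier G" for g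
      proof -
        obtain u v where uv: "u \<in> generate G S" "v \<in> carrier G" "g = u \<otimes> v [^] int m"
          using g eq(1) mem_span_mod_iff by metis
        obtain u' w where uw: "u' \<in> generate G S" "w \<in> carrier G" "v = u' \<otimes> w [^] int p"
          using uv(2) eq(2) mem_span_mod_iff by metis
        have c: "u \<in> carrier G" "u' \<in> carrier G"
          using uv uw subgroup.mem_carrier[OF sub] by auto
        have "g = (u \<otimes> u' [^] int m) \<otimes> w [^] int k"
          using uv uw c by (simp add: m int_pow_distrib int_pow_pow m_assoc mult.commute)
        moreover have "u \<otimes> u' [^] int m \<in> generate G S"
          using uv uw by (intro subgroup.m_closed[OF sub] subgroup_int_pow_closed[OF sub])
        ultimately show ?thesis using uw(2) mem_span_mod_iff by blast
      qed
      then show ?thesis using subgroup.subset[OF subgroup_span_mod[OF S]] by auto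
    qed
  qed
  then have "span_mod (order G) S = carrier G" by simp
  moreover have "span_mod (order G) S \<subseteq> generate G S"
    using subgroup.one_closed[OF sub] pow_order_eq_1
    by (intro span_mod_subset sub) (auto simp: powers_def int_pow_int intro: generate.incl)
  ultimately show ?thesis using subgroup.subset[OF sub] by auto
qed

text \<open>
  Generating sets modulo the various primes \<open>p\<close> are merged into one by taking the product of
  their \<open>i\<close>-th elements, each raised to the product of the other primes.
\<close>

lemma exists_generating_set:
  assumes fin: "finite (carrier G)"
    and T: "\<And>p. prime p \<Longrightarrow> p dvd order G \<Longrightarrow>
      \<exists>T\<subseteq>carrier G. card T \<le> n \<and> span_mod p T = carrier G"
  shows "\<exists>S\<subseteq>carrier G. card S \<le> n \<and> generate G S = carrier G"
proof -
  define P where "P = {p. prime p \<and> p dvd order G}"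
  have "order G > 0" using fin order_gt_0_iff_finite by simp
  then have finP: "finite P" by (auto simp: P_def intro: finite_subset[of _ "{..order G}"] dest: dvd_imp_le)
  have "\<exists>f. f ` {..<n} \<subseteq> carrier G \<and> span_mod p (f ` {..<n}) = carrier G" if "p \<in> P" for p
  proof -
    obtain T where T': "T \<subseteq> carrier G" "card T \<le> n" "span_mod p T = carrier G"
      using T[of p] \<open>p \<in> P\<close> unfolding P_def by blast
    obtain h where h: "bij_betw h {0..<card T} T"
      using ex_bij_betw_nat_finite finite_subset[OF T'(1) fin] by blast
    \<comment> \<open>Padding with \<open>\<one>\<close> gives every prime exactly \<open>n\<close>
      slots, so the families can be multiplied slot by slot.\<close>
    define f where "f i = (if i < card T then h i else \<one>)" for i
    have "f ` {..<n} \<subseteq> carrier G"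
      using T'(1) bij_betwE[OF h] by (auto simp: f_def)
    moreover have "T \<subseteq> f ` {..<n}"
    proof
      fix t assume "t \<in> T"
      then obtain i where "i < card T" "t = h i"
        using bij_betw_imp_surj_on[OF h] by (metis atLeastLessThan_iff imageE)
      then show "t \<in> f ` {..<n}" using T'(2) by (auto simp: f_def intro!: image_eqI[of _ _ i])
    qed
    ultimately have f: "f ` {..<n} \<subseteq> carrier G" "T \<subseteq> f ` {..<n}" by auto
    have "span_mod p T \<subseteq> span_mod p (f ` {..<n})"
      by (rule span_mod_subset[OF subgroup_span_mod[OF f(1)]
            subset_trans[OF f(2) subset_span_mod(1)[OF f(1)]] subset_span_mod(2)[OF f(1)]])
    then have "span_mod p (f ` {..<n}) = carrier G"
      using T'(3) subgroup.subset[OF subgroup_span_mod[OF f(1)]] by auto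
    then show ?thesis using f(1) by blast
  qed
  then have "\<forall>p\<in>P. \<exists>f. f ` {..<n} \<subseteq> carrier G \<and> span_mod p (f ` {..<n}) = carrier G" by blast
  from bchoice[OF this] obtain f where f: "\<And>p. p \<in> P \<Longrightarrow> f p ` {..<n} \<subseteq> carrier G"
    "\<And>p. p \<in> P \<Longrightarrow> span_mod p (f p ` {..<n}) = carrier G" by blast
  have fc: "f p i \<in> carrier G" if "p \<in> P" "i < n" for p i using f(1) that by blast
  define e where "e p = int (\<Prod>(P - {p}))" for p
  define s where "s i = monomial G (\<lambda>p. f p i) P e" for i
  have S: "s ` {..<n} \<subseteq> carrier G" using fc by (auto simp: s_def)
  have "span_mod q (s ` {..<n}) = carrier G" if q: "q \<in> P" for q
  proof -
    let ?K = "span_mod q (s ` {..<n})"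
    have K: "subgroup ?K G" by (intro subgroup_span_mod S)
    have powK: "x [^] k \<in> ?K" if x: "x \<in> carrier G" and k: "int q dvd k" for x k
    proof -
      obtain l where "k = int q * l" using k by (elim dvdE)
      then have "x [^] k = (x [^] l) [^] int q" using x by (simp add: int_pow_pow mult.commute)
      then have "x [^] k \<in> powers (int q)" using x by (simp add: powers_def)
      then show ?thesis using subset_span_mod(2)[OF S] by blast
    qed
    have "f q i \<in> ?K" if i: "i < n" for i
    proof (rule mem_subgroup_of_coprime_pows[OF K])
      \<comment> \<open>All factors of \<open>s i\<close> with \<open>p\<close> different from
        \<open>q\<close> are thus \<open>q\<close>-th powers, and \<open>s i\<close> agrees with
        \<open>f q i [^] e q\<close> modulo \<open>?K\<close>. Since \<open>e q\<close> is coprime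
        to \<open>q\<close>, \<open>f q i\<close> itself is recovered.\<close>
      have "int q dvd e p" if "p \<in> P" "p \<noteq> q" for p
        unfolding e_def using finP q that by (auto intro: dvd_prod_eqI)
      then have "s i \<in> ?K \<longleftrightarrow> f q i [^] e q \<in> ?K"
        unfolding s_def[of i] using fc i by (intro monomial_mem_subgroup_iff finP q K) (auto intro: powK)
      then show "f q i [^] e q \<in> ?K" using subset_span_mod(1)[OF S] i by auto
      show "f q i [^] int q \<in> ?K" "f q i \<in> carrier G" using fc[OF q i] by (auto intro: powK)
      have "coprime (\<Prod>(P - {q})) q"
        using q by (intro prod_coprime_left) (auto simp: P_def intro: primes_coprime)
      then show "coprime (e q) (int q)" by (simp add: e_def del: of_nat_prod)
    qed
    then have "span_mod q (f q ` {..<n}) \<subseteq> ?K"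
      using subset_span_mod(2)[OF S] by (intro span_mod_subset K) auto
    then show ?thesis using f(2)[OF q] subgroup.subset[OF K] by auto
  qed
  then have "generate G (s ` {..<n}) = carrier G"
    by (intro generate_eq_carrier_if_span_mod fin S) (auto simp: P_def)
  moreover have "card (s ` {..<n}) \<le> n" using card_image_le[of "{..<n}" s] by simp
  ultimately show ?thesis using S by blast
qed

text \<open>A smallest spanning set modulo \<open>p\<close> is independent. Were all of them smaller
  than \<open>min_generators G\<close>, merging them over the primes would give too few generators
  of \<open>G\<close>.\<close>

lemma exists_independent_mod_prime:
  assumes fin: "finite (carrier G)"
  shows "\<exists>p T. prime p \<and> T \<subseteq> carrier G \<and> min_generators G \<le> card T \<and>
           (\<forall>t\<in>T. t \<notin> span_mod p (T - {t}))" (is ?ex)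
proof (rule ccontr)
  assume *: "\<not> ?ex"
  \<comment> \<open>The bound \<open>min_generators G - 1\<close> is a natural subtraction; at 0 the
    empty set already witnesses the claim.\<close>
  have pos: "min_generators G > 0"
  proof (rule gr0I)
    assume "min_generators G = 0"
    then have ?ex
      using two_is_prime_nat by (intro exI[of _ 2] exI[of _ "{}"]) simp
    with * show False by contradiction
  qed
  have "\<exists>T\<subseteq>carrier G. card T \<le> min_generators G - 1 \<and> span_mod p T = carrier G"
    if p: "prime p" for p
  proof -
    have "carrier G = span_mod p (carrier G)"
      using subset_span_mod[of "carrier G"] subgroup.subset[OF subgroup_span_mod, of "carrier G"] by blast
    then have "\<exists>T. (T \<subseteq> carrier G \<and> span_mod p T = carrier G) \<and>
      (\<forall>U. U \<subseteq> carrier G \<and> span_mod p U = carrier G \<longrightarrow> card T \<le> card U)"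
      by (intro ex_has_least_nat[where P = "\<lambda>U. U \<subseteq> carrier G \<and> span_mod p U = carrier G"]) auto
    then obtain T where T: "T \<subseteq> carrier G" "span_mod p T = carrier G"
      and "\<forall>U. U \<subseteq> carrier G \<and> span_mod p U = carrier G \<longrightarrow> card T \<le> card U"
      by (elim exE conjE)
    then have least: "card T \<le> card U" if "U \<subseteq> carrier G" "span_mod p U = carrier G" for U
      using that by simp
    have "t \<notin> span_mod p (T - {t})" if "t \<in> T" for t
    proof
      assume t: "t \<in> span_mod p (T - {t})"
      have c: "T - {t} \<subseteq> carrier G" using T by auto
      have "span_mod p T \<subseteq> span_mod p (T - {t})"
        using t subset_span_mod[OF c] by (intro span_mod_subset subgroup_span_mod c) auto
      then have "card T \<le> card (T - {t})"
        using T(2) subgroup.subset[OF subgroup_span_mod[OF c]] by (intro least c) auto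
      then show False using card_Diff1_less[OF finite_subset[OF T(1) fin] that] by simp
    qed
    then have "\<not> min_generators G \<le> card T" using * p T(1) by blast
    then show ?thesis using T by (intro exI[of _ T]) auto
  qed
  then have "\<exists>S\<subseteq>carrier G. card S \<le> min_generators G - 1 \<and> generate G S = carrier G"
    by (intro exists_generating_set fin)
  then obtain S where "S \<subseteq> carrier G" "card S \<le> min_generators G - 1" "generate G S = carrier G"
    by (elim exE conjE)
  moreover from this have "min_generators G \<le> card S"
    unfolding min_generators_def using fin by (intro Least_le) (auto intro: finite_subset)
  ultimately show False using pos by simp
qed

text \<open>
  The system consists of the coordinate hyperplanes together with the hyperplane on which the
  coordinates sum to \<open>1\<close>, pulled back along \<open>G \<rightarrow> G / G\<^sup>p\<close>.
\<close>

lemma card_independent_less_helly: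
  assumes fin: "finite (carrier G)" and p: "prime p" and T: "T \<subseteq> carrier G"
    and indep: "\<And>t. t \<in> T \<Longrightarrow> t \<notin> span_mod p (T - {t})"
    and helly: "helly_property G e" and "e > 0"
  shows "card T < e"
proof (cases "T = {}")
  case False
  then obtain t0 where t0: "t0 \<in> T" by auto
  have finT: "finite T" using T fin finite_subset by blast
  have Tc: "(\<lambda>t. t) \<in> T \<rightarrow> carrier G" using T by auto
  let ?m = "monomial G (\<lambda>t. t) T"
  define K where "K t = span_mod p (T - {t})" for t
  have TK: "T - {t} \<subseteq> carrier G" for t using T by auto
  have K: "subgroup (K t) G" "T - {t} \<subseteq> K t" "powers (int p) \<subseteq> K t" for t
    using subgroup_span_mod[OF TK] subset_span_mod[OF TK] by (auto simp: K_def)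
  \<comment> \<open>Membership asks for some representation with coordinate sum congruent to
    \<open>r\<close>, so closure under products and inverses is immediate, before anything is known
    about uniqueness of coordinates.\<close>
  define L where "L r = {?m a \<otimes> v [^] int p | a v. v \<in> carrier G \<and> int p dvd (\<Sum>t\<in>T. a t) - r}"
    for r :: int
  have LI: "?m a \<otimes> v [^] int p \<in> L r" if "v \<in> carrier G" "int p dvd (\<Sum>t\<in>T. a t) - r" for a v r
    using that by (auto simp: L_def)
  have L_mult: "x \<otimes> y \<in> L (r + s)" if "x \<in> L r" "y \<in> L s" for x y r s
  proof -
    obtain a v b w where ab: "x = ?m a \<otimes> v [^] int p" "v \<in> carrier G" "int p dvd (\<Sum>t\<in>T. a t) - r"
      "y = ?m b \<otimes> w [^] int p" "w \<in> carrier G" "int p dvd (\<Sum>t\<in>T. b t) - s"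
      using \<open>x \<in> L r\<close> \<open>y \<in> L s\<close> by (auto simp: L_def)
    have "x \<otimes> y = (?m a \<otimes> ?m b) \<otimes> (v \<otimes> w) [^] int p"
      using ab Tc by (simp add: int_pow_distrib m_ac)
    also have "\<dots> = ?m (\<lambda>t. a t + b t) \<otimes> (v \<otimes> w) [^] int p"
      using Tc by (simp add: monomial_mult)
    also have "\<dots> \<in> L (r + s)"
      using ab dvd_add[OF ab(3,6)] by (intro LI) (auto simp: sum.distrib algebra_simps)
    finally show ?thesis .
  qed
  have L_inv: "inv x \<in> L (- r)" if x: "x \<in> L r" for x r
  proof -
    obtain a v where a: "x = ?m a \<otimes> v [^] int p" "v \<in> carrier G" "int p dvd (\<Sum>t\<in>T. a t) - r"
      using x by (auto simp: L_def)
    have "inv x = ?m (\<lambda>t. - a t) \<otimes> (inv v) [^] int p"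
      using a Tc by (simp add: inv_mult monomial_inv int_pow_inv)
    also have "\<dots> \<in> L (- r)"
      using a by (intro LI) (auto simp: sum_negf dvd_diff_commute)
    finally show ?thesis .
  qed
  have L_carrier: "L r \<subseteq> carrier G" for r using Tc by (auto simp: L_def)
  have one_L: "\<one> \<in> L 0"
    using LI[of \<one> "\<lambda>_. 0" 0] by simp
  have T_L: "t \<in> L 1" if "t \<in> T" for t
    using LI[of \<one> "\<lambda>i. if i = t then 1 else 0" 1] monomial_indicator[OF finT that Tc] that T finT
    by auto
  have L0: "subgroup (L 0) G"
  proof (rule subgroupI)
    show "L 0 \<noteq> {}" using one_L by auto
  qed (use L_carrier L_mult[of _ 0 _ 0] L_inv[of _ 0] in auto)
  have L1: "L 1 = t0 <# L 0"
  proof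
    show "t0 <# L 0 \<subseteq> L 1" using L_mult[OF T_L[OF t0], of _ 0] by (auto simp: l_coset_def)
    show "L 1 \<subseteq> t0 <# L 0"
    proof
      fix x assume x: "x \<in> L 1"
      have "x \<otimes> inv t0 \<in> L 0" using L_mult[OF x L_inv[OF T_L[OF t0]]] by simp
      then show "x \<in> t0 <# L 0"
        using x L_carrier T t0 by (subst mem_l_coset_iff[OF L0]) auto
    qed
  qed
  \<comment> \<open>Lying in \<open>K t\<close> forces \<open>p\<close> to divide the coordinate
    \<open>a t\<close>: otherwise \<open>t [^] a t\<close> and \<open>t [^] p\<close> would put
    \<open>t\<close> into \<open>K t\<close>. Then \<open>p\<close> divides the coordinate sum,
    which is 1 modulo \<open>p\<close>.\<close>
  have empty: "False" if x: "x \<in> L 1" "\<And>t. t \<in> T \<Longrightarrow> x \<in> K t" for x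
  proof -
    obtain a v where a: "x = ?m a \<otimes> v [^] int p" "v \<in> carrier G" "int p dvd (\<Sum>t\<in>T. a t) - 1"
      using x(1) by (auto simp: L_def)
    have "int p dvd a t" if t: "t \<in> T" for t
    proof (rule ccontr)
      assume "\<not> int p dvd a t"
      then have cop: "coprime (a t) (int p)"
        using p by (simp add: prime_imp_coprime coprime_commute)
      have "v [^] int p \<in> K t" using K(3) a(2) by (auto simp: powers_def)
      then have "?m a \<in> K t"
        using x(2)[OF t] Tc K(1) by (simp add: a(1) subgroup_mult_left_iff)
      then have "t [^] a t \<in> K t"
        using K(2)[of t] subgroup_int_pow_closed[OF K(1)]
        by (subst (asm) monomial_mem_subgroup_iff[OF finT t Tc K(1)]) auto
      moreover have "t [^] int p \<in> K t" using K(3)[of t] t T by (auto simp: powers_def)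
      moreover have "t \<in> carrier G" using t T by auto
      ultimately have "t \<in> K t"
        using mem_subgroup_of_coprime_pows[OF K(1) _ _ _ cop] by blast
      then show False using indep[OF t] by (simp add: K_def)
    qed
    then have "int p dvd (\<Sum>t\<in>T. a t)" by (intro dvd_sum)
    from dvd_diff[OF this a(3)] have "int p dvd 1" by simp
    then show False using prime_gt_1_nat[OF p] by (simp add: zdvd1_eq)
  qed
  define \<C> where "\<C> = insert (L 1) (K ` T)"
  have in_K: "t \<in> K t'" if "t \<in> T" "t' \<in> T" "t \<noteq> t'" for t t' using K(2) that by auto
  have notin_K: "t \<notin> K t" if "t \<in> T" for t using indep that by (simp add: K_def)
  \<comment> \<open>The system is a set, so its members must be distinct to number
    \<open>card T + 1\<close>.\<close>
  have inj: "inj_on K T" using in_K notin_K by (metis inj_onI)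
  have one_K: "\<one> \<in> K t" for t using K(1) subgroup.one_closed by blast
  have "\<one> \<notin> L 1" using empty[of \<one>] one_K by auto
  then have "L 1 \<notin> K ` T" using one_K by auto
  then have card: "card \<C> = card T + 1"
    using finT inj by (simp add: \<C>_def card_image)
  have "\<C> \<subseteq> left_cosets G"
  proof -
    have "K t = \<one> <# K t" for t
      using subgroup.mem_carrier[OF K(1)] by (auto simp: mem_l_coset_iff[OF K(1)])
    then have "K t \<in> left_cosets G" for t unfolding left_cosets_def using K(1) by blast
    moreover have "L 1 \<in> left_cosets G" unfolding left_cosets_def using L0 L1 t0 T by blast
    ultimately show ?thesis by (auto simp: \<C>_def)
  qed
  moreover have "carrier G \<inter> \<Inter>\<C> = {}" using empty by (auto simp: \<C>_def)
  moreover have "finite \<C>" using finT by (simp add: \<C>_def)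
  ultimately have "\<exists>\<D>\<subseteq>\<C>. card \<D> \<le> e \<and> carrier G \<inter> \<Inter>\<D> = {}"
    by (intro helly[unfolded helly_property_def, rule_format] conjI)
  then obtain \<D> where D: "\<D> \<subseteq> \<C>" "card \<D> \<le> e" "carrier G \<inter> \<Inter>\<D> = {}"
    by (elim exE conjE)
  have "L 1 \<in> \<D>"
  proof (rule ccontr)
    assume "L 1 \<notin> \<D>"
    then have "\<one> \<in> \<Inter>\<D>" using D(1) one_K by (auto simp: \<C>_def)
    then show False using D(3) by auto
  qed
  moreover have "K t \<in> \<D>" if t: "t \<in> T" for t
  proof (rule ccontr)
    assume "K t \<notin> \<D>"
    then have "t \<in> C" if "C \<in> \<D>" for C using that D(1) t in_K T_L by (auto simp: \<C>_def)
    then show False using D(3) t T by auto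
  qed
  ultimately have "\<D> = \<C>" using D(1) by (auto simp: \<C>_def)
  then show ?thesis using card D(2) by simp
\<comment> \<open>For empty \<open>T\<close> there is no \<open>t0\<close> to anchor the coset
  \<open>L 1\<close>; the bound is then positivity of \<open>e\<close>, which also settles the
  trivial group.\<close>
qed (use \<open>e > 0\<close> in simp)

end

theorem corollary2p3:
  fixes A :: "('a, 'b) monoid_scheme" and d :: nat
  assumes "comm_group A" and "finite (carrier A)" and "min_generators A = d"
  shows "helly_dimension A = d + 1"
proof -
  interpret comm_group A by fact
  \<comment> \<open>The finite carrier generates, so the \<open>LEAST\<close> in
    \<open>min_generators\<close> is attained.\<close>
  have "generate A (carrier A) = carrier A"
    using generate_incl[of "carrier A"] generate.incl[of _ "carrier A" A] by auto
  then have "\<exists>S. S \<subseteq> carrier A \<and> finite S \<and> card S = d \<and> generate A S = carrier A"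
    unfolding assms(3)[symmetric] min_generators_def using assms(2)
    by (intro LeastI_ex[of "\<lambda>n. \<exists>S. S \<subseteq> carrier A \<and> finite S \<and> card S = n \<and> generate A S = carrier A"]) auto
  then have upper: "helly_property A (d + 1)"
    using helly_property_Suc_card_generators[OF assms(2)] by blast
  obtain p T where T: "prime p" "T \<subseteq> carrier A" "d \<le> card T" "\<forall>t\<in>T. t \<notin> span_mod p (T - {t})"
    using exists_independent_mod_prime[OF assms(2)] assms(3) by blast
  show ?thesis
    unfolding helly_dimension_def
  proof (rule Least_equality)
    fix e assume "0 < e \<and> helly_property A e"
    then have "card T < e"
      using card_independent_less_helly[OF assms(2) T(1,2)] T(4) by blast
    then show "d + 1 \<le> e" using T(3) by simp
  qed (use upper in simp)
qed

end
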